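(* For every $g\in W(\mathbf{Z})$ we have $\langle g(f_n),f_n\rangle/\|f_n\|^2\to 1$ as $n\to\infty$. Moreover, $\|f_n|_{x_0=0}\|/\|f_n\|\to 1$ as $n\to\infty$.
   Context: $W(\mathbf{Z})$ denotes the group (under composition) of all bijections $g\colon\mathbf{Z}\to\mathbf{Z}$ for which $|g|_{\mathrm w}:=\sup\{|g(j)-j| : j\in\mathbf{Z}\}$ is finite. For each integer $n\ge 1$ define $f_n\colon\{0,1\}^{\mathbf{Z}}\to(0,1]$ by $$f_n(x)=\exp\Big(-n\sum_{j\in\mathbf{Z}}x_je^{-|j|/n}\Big),\qquad x=\{x_j\}_{j\in\mathbf{Z}}.$$ It is viewed as an element of the Hilbert space $L^2(\{0,1\}^{\mathbf{Z}})$, where $\{0,1\}^{\mathbf{Z}}$ carries the symmetric Bernoulli measure (the product of the uniform measures on $\{0,1\}$); $\langle\cdot,\cdot\rangle$ and $\|\cdot\|$ are the inner product and norm of this Hilbert space. The group $W(\mathbf{Z})$ acts on $\{0,1\}^{\mathbf{Z}}$ by permuting coordinates, $(gx)_j=x_{g^{-1}(j)}$, and on functions by $(g(f))(x)=f(g^{-1}x)$. The notation $f_n|_{x_0=0}$ represents the function $f_n$ multiplied by the characteristic function of the cylinder set $\{x : x_0=0\}$. *)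

theory Defs
  imports "HOL-Probability.Probability" "HOL-Library.Extended_Nat"
begin

section \<open>The wobbling group of the integers\<close>

definition wnorm :: "(int \<Rightarrow> int) \<Rightarrow> enat" where
  "wnorm g = (SUP j. enat (nat \<bar>g j - j\<bar>))"

definition W :: "(int \<Rightarrow> int) set" where
  "W = {g. bij g \<and> wnorm g < \<infinity>}"

lemma wnorm_finite_iff: "wnorm g < \<infinity> \<longleftrightarrow> (\<exists>B. \<forall>j. \<bar>g j - j\<bar> \<le> B)"
proof
  assume "wnorm g < \<infinity>"
  then obtain m where m: "wnorm g = enat m" by (cases "wnorm g") auto
  have "\<bar>g j - j\<bar> \<le> int m" for j
  proof -
    have "enat (nat \<bar>g j - j\<bar>) \<le> wnorm g"
      unfolding wnorm_def by (rule SUP_upper) simp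
    then show ?thesis using m by simp
  qed
  then show "\<exists>B. \<forall>j. \<bar>g j - j\<bar> \<le> B" by blast
next
  assume "\<exists>B. \<forall>j. \<bar>g j - j\<bar> \<le> B"
  then obtain B where B: "\<And>j. \<bar>g j - j\<bar> \<le> B" by blast
  have "wnorm g \<le> enat (nat B)"
    unfolding wnorm_def by (rule SUP_least) (use B in \<open>auto intro: nat_mono\<close>)
  then show "wnorm g < \<infinity>" using enat_ord_code(4) le_less_trans by blast
qed

lemma id_in_W: "id \<in> W"
  unfolding W_def wnorm_finite_iff by auto

lemma comp_in_W:
  assumes "g \<in> W" "h \<in> W"
  shows "g \<circ> h \<in> W"
proof -
  from assms obtain A B where A: "\<And>j. \<bar>g j - j\<bar> \<le> A" and B: "\<And>j. \<bar>h j - j\<bar> \<le> B"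
    unfolding W_def wnorm_finite_iff by auto
  have "\<bar>(g \<circ> h) j - j\<bar> \<le> A + B" for j
    using A[of "h j"] B[of j] by simp
  then show ?thesis
    using assms bij_comp unfolding W_def wnorm_finite_iff by blast
qed

lemma inv_in_W:
  assumes "g \<in> W"
  shows "inv g \<in> W"
proof -
  from assms obtain A where A: "\<And>j. \<bar>g j - j\<bar> \<le> A" and g: "bij g"
    unfolding W_def wnorm_finite_iff by auto
  have "\<bar>inv g j - j\<bar> \<le> A" for j
    using A[of "inv g j"] bij_is_surj[OF g] by (simp add: surj_f_inv_f abs_minus_commute)
  then show ?thesis
    using g bij_imp_bij_inv unfolding W_def wnorm_finite_iff by blast
qed


section \<open>The Hilbert space of the Bernoulli measure\<close>

text \<open>A point of \<open>{0,1}\<^sup>\<int>\<close> is a function \<open>int \<Rightarrow> bool\<close>; its coordinate \<open>x\<^sub>j \<in> {0,1}\<close>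
  is \<open>of_bool (x j)\<close>.\<close>

definition bernoulli_measure :: "(int \<Rightarrow> bool) measure" where
  "bernoulli_measure = PiM UNIV (\<lambda>_. measure_pmf (pmf_of_set UNIV))"

text \<open>Square-integrable functions are not identified almost everywhere: the functionals below
  do not distinguish representatives. They are meaningful only on \<open>L2\<close>, since the Bochner
  integral of a non-integrable function is 0 by convention. Real scalars suffice, as all
  functions considered are real-valued.\<close>

definition L2 :: "((int \<Rightarrow> bool) \<Rightarrow> real) set" where
  "L2 = {u \<in> borel_measurable bernoulli_measure. integrable bernoulli_measure (\<lambda>x. (u x)\<^sup>2)}"

definition L2_inner :: "((int \<Rightarrow> bool) \<Rightarrow> real) \<Rightarrow> ((int \<Rightarrow> bool) \<Rightarrow> real) \<Rightarrow> real" where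
  "L2_inner u v = (LINT x|bernoulli_measure. u x * v x)"

definition L2_norm :: "((int \<Rightarrow> bool) \<Rightarrow> real) \<Rightarrow> real" where
  "L2_norm u = sqrt (L2_inner u u)"


section \<open>The action of the wobbling group\<close>

definition act :: "(int \<Rightarrow> int) \<Rightarrow> (int \<Rightarrow> bool) \<Rightarrow> (int \<Rightarrow> bool)" where
  "act g x = (\<lambda>j. x (inv g j))"

definition act_fun ::
    "(int \<Rightarrow> int) \<Rightarrow> ((int \<Rightarrow> bool) \<Rightarrow> real) \<Rightarrow> ((int \<Rightarrow> bool) \<Rightarrow> real)" where
  "act_fun g u = (\<lambda>x. u (act (inv g) x))"


section \<open>The functions \<open>f\<^sub>n\<close>\<close>

definition f :: "nat \<Rightarrow> (int \<Rightarrow> bool) \<Rightarrow> real" where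
  "f n x = exp (- real n *
     (\<Sum>\<^sub>\<infinity>j\<in>UNIV. of_bool (x j) * exp (- real_of_int \<bar>j\<bar> / real n)))"

definition restrict_cyl :: "((int \<Rightarrow> bool) \<Rightarrow> real) \<Rightarrow> ((int \<Rightarrow> bool) \<Rightarrow> real)" where
  "restrict_cyl u = (\<lambda>x. u x * indicator {x. x 0 = False} x)"

text \<open>The series defining \<open>f n\<close> converges, so the \<open>infsum\<close> above is a genuine sum, and the
  functions in question are elements of \<open>L2\<close>.\<close>

lemma f_summable:
  assumes "n \<ge> 1"
  shows "(\<lambda>j. of_bool (x j) * exp (- real_of_int \<bar>j\<bar> / real n)) summable_on UNIV"
proof -
  let ?e = "\<lambda>j::int. exp (- real_of_int \<bar>j\<bar> / real n)"
  let ?r = "exp (- 1 / real n)"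
  have r: "norm ?r < 1" using assms by simp
  have pow: "?e (int k) = ?r ^ k" "?e (- int k) = ?r ^ k" for k
    by (simp_all flip: exp_of_nat_mult)
  have geo: "(\<lambda>k. ?r ^ k) summable_on UNIV"
    by (rule norm_summable_imp_summable_on) (use summable_geometric[of "norm ?r"] r in \<open>simp add: norm_power\<close>)
  have "?e summable_on range int"
    using geo by (subst summable_on_reindex) (auto simp: o_def pow[simplified] inj_on_def)
  moreover have "?e summable_on range (\<lambda>k. - int k)"
    using geo by (subst summable_on_reindex) (auto simp: o_def pow[simplified] inj_on_def)
  ultimately have "?e summable_on (range int \<union> range (\<lambda>k. - int k))"
    by (rule summable_on_union)
  moreover have "range int \<union> range (\<lambda>k. - int k) = UNIV"
  proof -
    have "j \<in> range int \<union> range (\<lambda>k. - int k)" for j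
      by (cases j rule: int_cases2) auto
    then show ?thesis by blast
  qed
  ultimately have "?e summable_on UNIV" by simp
  then show ?thesis
    by (rule summable_on_comparison_test) auto
qed

lemma f_range:
  shows "0 < f n x" "f n x \<le> 1"
  unfolding f_def by (auto intro!: mult_nonneg_nonneg infsum_nonneg)

lemma f_measurable:
  assumes "n \<ge> 1"
  shows "f n \<in> borel_measurable bernoulli_measure"
proof -
  let ?t = "\<lambda>x j::int. of_bool (x j) * exp (- real_of_int \<bar>j\<bar> / real n)"
  have lim: "filterlim (\<lambda>N. {- int N..int N}) (finite_subsets_at_top UNIV) sequentially"
    unfolding filterlim_finite_subsets_at_top
  proof (intro allI impI)
    fix X :: "int set" assume X: "finite X \<and> X \<subseteq> UNIV"
    define B where "B = nat (Max (insert 0 (abs ` X)))"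
    have B: "\<bar>j\<bar> \<le> int B" if "j \<in> X" for j
    proof -
      have "\<bar>j\<bar> \<le> Max (insert 0 (abs ` X))" using X that by (intro Max_ge) auto
      then show ?thesis unfolding B_def by linarith
    qed
    show "\<forall>\<^sub>F N in sequentially. finite {- int N..int N} \<and> X \<subseteq> {- int N..int N} \<and> {- int N..int N} \<subseteq> UNIV"
      using eventually_ge_at_top[of B]
    proof eventually_elim
      case (elim N)
      have "j \<in> {- int N..int N}" if "j \<in> X" for j using B[OF that] elim by auto
      then show ?case by blast
    qed
  qed
  have coord: "(\<lambda>x. x j) \<in> measurable bernoulli_measure (count_space UNIV)" for j :: int
    unfolding bernoulli_measure_def
    using measurable_component_singleton[of j UNIV "\<lambda>_. measure_pmf (pmf_of_set (UNIV::bool set))"]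
    by simp
  have "(\<lambda>x. of_bool (x j)) \<in> borel_measurable bernoulli_measure" for j :: int
    using measurable_compose[OF coord, of of_bool borel] by simp
  then have "(\<lambda>x. \<Sum>j\<in>{- int N..int N}. ?t x j) \<in> borel_measurable bernoulli_measure" for N
    by (intro borel_measurable_sum borel_measurable_times) auto
  moreover have "(\<lambda>N. \<Sum>j\<in>{- int N..int N}. ?t x j) \<longlonglongrightarrow> infsum (?t x) UNIV" for x
    by (rule filterlim_compose[OF _ lim]) (rule infsum_tendsto[OF f_summable[OF assms]])
  ultimately have "(\<lambda>x. infsum (?t x) UNIV) \<in> borel_measurable bernoulli_measure"
    by (rule borel_measurable_LIMSEQ_real[rotated])
  then show ?thesis unfolding f_def by measurable
qed

lemma prob_space_bernoulli_measure: "prob_space bernoulli_measure"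
  unfolding bernoulli_measure_def by (intro prob_space_PiM prob_space_measure_pmf)

lemma space_bernoulli_measure: "space bernoulli_measure = UNIV"
  by (simp add: bernoulli_measure_def space_PiM)

lemma L2_I_bounded:
  assumes "u \<in> borel_measurable bernoulli_measure" "\<And>x. \<bar>u x\<bar> \<le> 1"
  shows "u \<in> L2"
proof -
  interpret prob_space bernoulli_measure by (rule prob_space_bernoulli_measure)
  have "integrable bernoulli_measure (\<lambda>x. (u x)\<^sup>2)"
    by (rule integrable_const_bound[of _ 1]) (use assms in \<open>auto simp: abs_square_le_1\<close>)
  then show ?thesis using assms unfolding L2_def by simp
qed

lemma f_in_L2: "n \<ge> 1 \<Longrightarrow> f n \<in> L2"
  using f_range[of n] by (intro L2_I_bounded f_measurable) (auto simp: less_imp_le)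

lemma act_measurable: "act g \<in> measurable bernoulli_measure bernoulli_measure"
  unfolding bernoulli_measure_def act_def
  by (rule measurable_PiM_single') (auto intro: measurable_component_singleton)

lemma act_fun_f_in_L2: "n \<ge> 1 \<Longrightarrow> act_fun g (f n) \<in> L2"
  unfolding act_fun_def using f_range[of n]
  by (intro L2_I_bounded measurable_compose[OF act_measurable] f_measurable) (auto simp: less_imp_le)

lemma restrict_cyl_f_in_L2:
  assumes "n \<ge> 1"
  shows "restrict_cyl (f n) \<in> L2"
proof -
  have "(\<lambda>x. x 0) \<in> measurable bernoulli_measure (count_space UNIV)"
    unfolding bernoulli_measure_def
    using measurable_component_singleton[of 0 UNIV "\<lambda>_. measure_pmf (pmf_of_set (UNIV::bool set))"]
    by simp
  then have "(\<lambda>x. indicator {False} (x 0) :: real) \<in> borel_measurable bernoulli_measure"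
    by (rule measurable_compose) simp
  also have "(\<lambda>x. indicator {False} (x 0) :: real) = indicator {x::int \<Rightarrow> bool. x 0 = False}"
    by (auto simp: indicator_def fun_eq_iff)
  finally have "restrict_cyl (f n) \<in> borel_measurable bernoulli_measure"
    unfolding restrict_cyl_def using f_measurable[OF assms] by (intro borel_measurable_times)
  moreover have "\<bar>restrict_cyl (f n) x\<bar> \<le> 1" for x
    using f_range[of n x] unfolding restrict_cyl_def by (auto simp: indicator_def)
  ultimately show ?thesis by (rule L2_I_bounded)
qed

end

theory Submission
  imports Defs
begin

text \<open>
  Write \<open>a\<^sub>j = n e\<^bsup>-|j|/n\<^esup>\<close>, so that \<open>f n x = exp (- \<Sum> x\<^sub>j a\<^sub>j)\<close>. The coordinates are independent
  and each factor depends on one of them, hence an integral of \<open>exp (- \<Sum> x\<^sub>j c\<^sub>j)\<close> is the infinite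
  product of the numbers \<open>(1 + e\<^bsup>-c\<^sub>j\<^esup>) / 2\<close> (\<open>laplace_eq_infinite_prod\<close>). The inner product
  \<open>\<langle>g(f\<^sub>n), f\<^sub>n\<rangle>\<close> has this form with \<open>c = a + b\<close>, where \<open>b = a \<circ> g\<^sup>-\<^sup>1\<close>, while \<open>\<parallel>f\<^sub>n\<parallel>\<^sup>2\<close> arises both
  from \<open>c = 2a\<close> and, because the measure is invariant under permutations, from \<open>c = 2b\<close>.

  With \<open>u\<^sub>j = e\<^bsup>-a\<^sub>j\<^esup>\<close> and \<open>v\<^sub>j = e\<^bsup>-b\<^sub>j\<^esup>\<close>, the Lagrange identity
  \<open>(1 + uv)\<^sup>2 = (1 + u\<^sup>2)(1 + v\<^sup>2) - (u - v)\<^sup>2\<close> in each factor shows that the square of the ratio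
  \<open>\<langle>g(f\<^sub>n), f\<^sub>n\<rangle> / \<parallel>f\<^sub>n\<parallel>\<^sup>2\<close> lies between \<open>1 - \<Sum> (u\<^sub>j - v\<^sub>j)\<^sup>2\<close> and 1
  (\<open>laplace_almost_multiplicative\<close>). So everything rests on \<open>\<Sum> (u\<^sub>j - v\<^sub>j)\<^sup>2 \<rightarrow> 0\<close>
  (\<open>sum_profile_displacement_le\<close>). Here \<open>u\<^sub>j = exp (- n e\<^bsup>-|j|/n\<^esup>)\<close> is an increasing function of
  \<open>|j|\<close> with values in \<open>[0, 1]\<close> and Lipschitz constant \<open>1/n\<close>. As \<open>g\<close> has bounded displacement,
  every difference is \<open>O(1/n)\<close>, while the sum of all the differences is \<open>O(1)\<close> by telescoping;
  the sum of the squares is therefore \<open>O(1/n)\<close>.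

  For the cylinder, restricting to \<open>x\<^sub>0 = 0\<close> changes only the factor at \<open>j = 0\<close>, which drops from
  \<open>(1 + e\<^bsup>-2n\<^esup>) / 2\<close> to \<open>1 / 2\<close>; hence \<open>\<parallel>f\<^sub>n\<parallel>\<^sup>2 = (1 + e\<^bsup>-2n\<^esup>) \<parallel>f\<^sub>n|\<^bsub>x\<^sub>0=0\<^esub>\<parallel>\<^sup>2\<close>.
\<close>

section \<open>Integrals of products over the Bernoulli measure\<close>

text \<open>Turns unordered sums over the integers into limits of sequences, which dominated
  convergence requires.\<close>

lemma symmetric_intervals_exhaust:
  "filterlim (\<lambda>N. {- int N..int N}) (finite_subsets_at_top UNIV) sequentially"
  unfolding filterlim_finite_subsets_at_top
proof (intro allI impI)
  fix X :: "int set" assume X: "finite X \<and> X \<subseteq> UNIV"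
  have "\<forall>\<^sub>F N in sequentially. j \<in> {- int N..int N}" for j
    using eventually_ge_at_top[of "nat \<bar>j\<bar>"] by eventually_elim auto
  then have "\<forall>\<^sub>F N in sequentially. \<forall>j\<in>X. j \<in> {- int N..int N}"
    using X by (intro eventually_ball_finite) auto
  then show "\<forall>\<^sub>F N in sequentially. finite {- int N..int N} \<and> X \<subseteq> {- int N..int N} \<and>
      {- int N..int N} \<subseteq> UNIV"
    by eventually_elim auto
qed

lemma coordinate_measurable: "(\<lambda>x. x j) \<in> measurable bernoulli_measure (count_space UNIV)"
  unfolding bernoulli_measure_def
  using measurable_component_singleton[of j UNIV "\<lambda>_. measure_pmf (pmf_of_set (UNIV::bool set))"]
  by simp

lemma coordinate_function_measurable:
  fixes w :: "bool \<Rightarrow> real"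
  shows "(\<lambda>x. w (x j)) \<in> borel_measurable bernoulli_measure"
  by (rule measurable_compose[OF coordinate_measurable]) simp

lemma integral_bernoulli_prod:
  fixes w :: "int \<Rightarrow> bool \<Rightarrow> real"
  assumes "finite F"
  shows "(LINT x|bernoulli_measure. (\<Prod>j\<in>F. w j (x j))) = (\<Prod>j\<in>F. (w j False + w j True) / 2)"
proof -
  let ?M = "\<lambda>_::int. measure_pmf (pmf_of_set (UNIV :: bool set))"
  interpret product_prob_space ?M UNIV by standard
  have w: "(\<lambda>x. w j (x j)) \<in> borel_measurable (PiM F ?M)" if "j \<in> F" for j
    by (rule measurable_compose[OF measurable_component_singleton[OF that]]) simp
  have "(LINT x|PiM F ?M. (\<Prod>j\<in>F. w j (x j))) =
      (LINT x|distr (PiM UNIV ?M) (PiM F ?M) (\<lambda>x. restrict x F). (\<Prod>j\<in>F. w j (x j)))"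
    by (subst distr_PiM_restrict_finite) (use assms in auto)
  also have "\<dots> = (LINT x|PiM UNIV ?M. (\<Prod>j\<in>F. w j (restrict x F j)))"
    by (rule integral_distr) (auto intro!: measurable_restrict_subset borel_measurable_prod w)
  also have "\<dots> = (LINT x|bernoulli_measure. (\<Prod>j\<in>F. w j (x j)))"
    unfolding bernoulli_measure_def by (intro Bochner_Integration.integral_cong prod.cong) auto
  finally have "(LINT x|bernoulli_measure. (\<Prod>j\<in>F. w j (x j))) = (LINT x|PiM F ?M. (\<Prod>j\<in>F. w j (x j)))" ..
  also have "\<dots> = (\<Prod>j\<in>F. integral\<^sup>L (?M j) (w j))"
    by (rule product_integral_prod[OF assms]) (rule integrable_measure_pmf_finite, simp)
  also have "\<dots> = (\<Prod>j\<in>F. (w j False + w j True) / 2)"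
    by (simp add: integral_pmf_of_set UNIV_bool)
  finally show ?thesis .
qed

text \<open>The partial products lie in \<open>[0, 1]\<close>, so dominated convergence applies. The factors are allowed
  to vanish: the indicator of a cylinder set is then covered as well.\<close>

lemma integral_bernoulli_infinite_prod:
  fixes w :: "int \<Rightarrow> bool \<Rightarrow> real"
  assumes w: "\<And>j b. 0 \<le> w j b" "\<And>j b. w j b \<le> 1"
    and lim: "\<And>x. (\<lambda>N. \<Prod>j\<in>{- int N..int N}. w j (x j)) \<longlonglongrightarrow> h x"
  shows "(\<lambda>N. \<Prod>j\<in>{- int N..int N}. (w j False + w j True) / 2)
           \<longlonglongrightarrow> (LINT x|bernoulli_measure. h x)"
proof -
  interpret prob_space bernoulli_measure by (rule prob_space_bernoulli_measure)
  have meas: "(\<lambda>x. \<Prod>j\<in>{- int N..int N}. w j (x j)) \<in> borel_measurable bernoulli_measure" for N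
    by (intro borel_measurable_prod coordinate_function_measurable)
  have "(\<lambda>N. LINT x|bernoulli_measure. (\<Prod>j\<in>{- int N..int N}. w j (x j)))
      \<longlonglongrightarrow> (LINT x|bernoulli_measure. h x)"
  proof (rule integral_dominated_convergence[where w = "\<lambda>_. 1"])
    show "h \<in> borel_measurable bernoulli_measure"
      by (rule borel_measurable_LIMSEQ_real[OF lim meas])
    show "AE x in bernoulli_measure. norm (\<Prod>j\<in>{- int N..int N}. w j (x j)) \<le> 1" for N
      using w by (intro AE_I2) (simp add: abs_prod prod_le_1)
  qed (use meas lim in auto)
  then show ?thesis by (simp add: integral_bernoulli_prod)
qed

text \<open>The Laplace transform, at 1, of the random sum of those \<open>c j\<close> that \<open>x\<close> selects.\<close>

definition laplace :: "(int \<Rightarrow> real) \<Rightarrow> real" where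
  "laplace c = (LINT x|bernoulli_measure. exp (- (\<Sum>\<^sub>\<infinity>j\<in>UNIV. of_bool (x j) * c j)))"

lemma summable_on_selection:
  fixes c :: "'a \<Rightarrow> real"
  assumes "\<And>j. 0 \<le> c j" "c summable_on UNIV"
  shows "(\<lambda>j. of_bool (x j) * c j) summable_on UNIV"
  by (rule summable_on_comparison_test[OF assms(2)]) (use assms(1) in auto)

lemma selection_prod_tendsto:
  fixes c :: "int \<Rightarrow> real"
  assumes "\<And>j. 0 \<le> c j" "c summable_on UNIV"
  shows "(\<lambda>N. \<Prod>j\<in>{- int N..int N}. exp (- (of_bool (x j) * c j)))
           \<longlonglongrightarrow> exp (- (\<Sum>\<^sub>\<infinity>j\<in>UNIV. of_bool (x j) * c j))"
proof -
  have "(\<lambda>N. \<Sum>j\<in>{- int N..int N}. of_bool (x j) * c j)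
      \<longlonglongrightarrow> (\<Sum>\<^sub>\<infinity>j\<in>UNIV. of_bool (x j) * c j)"
    by (rule filterlim_compose[OF _ symmetric_intervals_exhaust])
      (rule infsum_tendsto[OF summable_on_selection[OF assms]])
  then have "(\<lambda>N. exp (- (\<Sum>j\<in>{- int N..int N}. of_bool (x j) * c j)))
      \<longlonglongrightarrow> exp (- (\<Sum>\<^sub>\<infinity>j\<in>UNIV. of_bool (x j) * c j))"
    by (intro tendsto_intros)
  then show ?thesis by (simp only: exp_sum finite_atLeastAtMost_int flip: sum_negf)
qed

lemma laplace_eq_infinite_prod:
  assumes "\<And>j. 0 \<le> c j" "c summable_on UNIV"
  shows "(\<lambda>N. \<Prod>j\<in>{- int N..int N}. (1 + exp (- c j)) / 2) \<longlonglongrightarrow> laplace c"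
  using integral_bernoulli_infinite_prod[of "\<lambda>j b. exp (- (of_bool b * c j))",
      OF _ _ selection_prod_tendsto[OF assms]] assms(1)
  by (simp add: laplace_def)

lemma selection_exp_measurable:
  assumes "\<And>j. 0 \<le> c j" "c summable_on UNIV"
  shows "(\<lambda>x. exp (- (\<Sum>\<^sub>\<infinity>j\<in>UNIV. of_bool (x j) * c j)) :: real) \<in> borel_measurable bernoulli_measure"
  by (rule borel_measurable_LIMSEQ_real[OF selection_prod_tendsto[OF assms]])
    (intro borel_measurable_prod coordinate_function_measurable)

lemma laplace_pos:
  assumes "\<And>j. 0 \<le> c j" "c summable_on UNIV"
  shows "0 < laplace c"
proof -
  interpret prob_space bernoulli_measure by (rule prob_space_bernoulli_measure)
  let ?h = "\<lambda>x. exp (- (\<Sum>\<^sub>\<infinity>j\<in>UNIV. of_bool (x j) * c j))"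
  have "?h x \<le> 1" for x
    using assms(1) by (auto intro!: infsum_nonneg)
  then have "integrable bernoulli_measure ?h"
    using selection_exp_measurable[OF assms] by (intro integrable_const_bound[of _ 1]) auto
  then have "(LINT x|bernoulli_measure. 0) < (LINT x|bernoulli_measure. ?h x)"
    by (intro integral_less_AE_space) (auto simp: emeasure_space_1)
  then show ?thesis by (simp add: laplace_def)
qed

lemma bernoulli_measure_permute:
  assumes h: "bij h"
  shows "distr bernoulli_measure bernoulli_measure (\<lambda>x j. x (h j)) = bernoulli_measure"
  using distr_PiM_reindex[of UNIV "\<lambda>_. measure_pmf (pmf_of_set (UNIV :: bool set))" h UNIV]
    bij_is_inj[OF h]
  by (simp add: bernoulli_measure_def prob_space_measure_pmf restrict_def)

lemma laplace_permute:
  assumes c: "\<And>j. 0 \<le> c j" "c summable_on UNIV" and h: "bij h"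
  shows "laplace (\<lambda>j. c (h j)) = laplace c"
proof -
  let ?e = "\<lambda>c x. exp (- (\<Sum>\<^sub>\<infinity>j\<in>UNIV. of_bool (x j) * c j)) :: real"
  let ?ch = "\<lambda>j. c (h j)"
  have ch: "?ch summable_on UNIV"
    using summable_on_reindex_bij_betw[OF h] c(2) by blast
  have T: "(\<lambda>x j. x (h j)) \<in> measurable bernoulli_measure bernoulli_measure"
    using act_measurable[of "inv h"] h by (simp add: act_def[abs_def] inv_inv_eq)
  have "laplace ?ch = (LINT x|distr bernoulli_measure bernoulli_measure (\<lambda>x j. x (h j)). ?e ?ch x)"
    by (simp add: bernoulli_measure_permute[OF h] laplace_def)
  also have "\<dots> = (LINT x|bernoulli_measure. ?e ?ch (\<lambda>j. x (h j)))"
    by (rule integral_distr[OF T selection_exp_measurable]) (use c ch in auto)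
  also have "\<dots> = laplace c"
    unfolding laplace_def by (simp add: infsum_reindex_bij_betw[OF h, of "\<lambda>j. of_bool (_ j) * c j"])
  finally show ?thesis .
qed

section \<open>Comparison of two Laplace transforms\<close>

text \<open>A relative form of the Weierstrass inequality \<open>\<Prod> (1 - d\<^sub>j) \<ge> 1 - \<Sum> d\<^sub>j\<close>. Individual \<open>d\<^sub>j\<close> may
  exceed 1, because the claim is trivial once their sum does.\<close>

lemma one_minus_sum_times_prod_le:
  fixes p q d :: "'a \<Rightarrow> real"
  assumes "finite F"
    and "\<And>j. j \<in> F \<Longrightarrow> 0 \<le> p j" "\<And>j. j \<in> F \<Longrightarrow> 0 \<le> q j" "\<And>j. j \<in> F \<Longrightarrow> 0 \<le> d j"
    and "\<And>j. j \<in> F \<Longrightarrow> (1 - d j) * q j \<le> p j"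
  shows "(1 - (\<Sum>j\<in>F. d j)) * (\<Prod>j\<in>F. q j) \<le> (\<Prod>j\<in>F. p j)"
  using assms
proof (induction F rule: finite_induct)
  case (insert i F)
  let ?S = "\<Sum>j\<in>F. d j" and ?Q = "\<Prod>j\<in>F. q j" and ?P = "\<Prod>j\<in>F. p j"
  have nn: "0 \<le> ?S" "0 \<le> ?Q" "0 \<le> ?P" "0 \<le> d i" "0 \<le> q i" "0 \<le> p i"
    using insert by (auto intro!: sum_nonneg prod_nonneg)
  have IH: "(1 - ?S) * ?Q \<le> ?P" using insert by auto
  have "(1 - (d i + ?S)) * (q i * ?Q) \<le> p i * ?P"
  proof (cases "?S \<le> 1")
    case True
    have "(1 - (d i + ?S)) * (q i * ?Q) \<le> (1 - d i) * (1 - ?S) * (q i * ?Q)"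
      using nn by (intro mult_right_mono) (auto simp: algebra_simps)
    also have "\<dots> = ((1 - d i) * q i) * ((1 - ?S) * ?Q)" by (simp add: algebra_simps)
    also have "\<dots> \<le> p i * ?P"
      using insert.prems(4)[of i] True nn IH by (intro mult_mono) auto
    finally show ?thesis .
  next
    case False
    then have "(1 - (d i + ?S)) * (q i * ?Q) \<le> 0"
      using nn by (intro mult_nonpos_nonneg) auto
    also have "0 \<le> p i * ?P" using nn by simp
    finally show ?thesis .
  qed
  then show ?case using insert.hyps by simp
qed simp

text \<open>The second inequality is the Cauchy-Schwarz inequality. The first is a reverse of it: factor by
  factor, the loss in Cauchy-Schwarz is exactly a multiple of \<open>(e\<^bsup>-a\<^sub>j\<^esup> - e\<^bsup>-b\<^sub>j\<^esup>)\<^sup>2\<close>, and these losses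
  add up to at most \<open>S\<close>.\<close>

lemma laplace_almost_multiplicative:
  assumes a: "\<And>j. 0 \<le> a j" "a summable_on UNIV"
    and b: "\<And>j. 0 \<le> b j" "b summable_on UNIV"
    and S: "\<And>N. (\<Sum>j\<in>{- int N..int N}. (exp (- a j) - exp (- b j))\<^sup>2) \<le> S"
  shows "(1 - S) * (laplace (\<lambda>j. 2 * a j) * laplace (\<lambda>j. 2 * b j)) \<le> (laplace (\<lambda>j. a j + b j))\<^sup>2"
    and "(laplace (\<lambda>j. a j + b j))\<^sup>2 \<le> laplace (\<lambda>j. 2 * a j) * laplace (\<lambda>j. 2 * b j)"
proof -
  let ?I = "\<lambda>N. {- int N..int N}"
  let ?p = "\<lambda>j. ((1 + exp (- (a j + b j))) / 2)\<^sup>2"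
  let ?q = "\<lambda>j. (1 + exp (- (2 * a j))) / 2 * ((1 + exp (- (2 * b j))) / 2)"
  let ?d = "\<lambda>j. (exp (- a j) - exp (- b j))\<^sup>2"
  have lagrange: "?p j = ?q j - ?d j / 4" for j
  proof -
    have "exp (- (a j + b j)) = exp (- a j) * exp (- b j)"
      "exp (- (2 * a j)) = (exp (- a j))\<^sup>2" "exp (- (2 * b j)) = (exp (- b j))\<^sup>2"
      by (simp_all add: power2_eq_square flip: exp_add)
    then show ?thesis by (simp add: power2_eq_square field_simps)
  qed
  \<comment> \<open>This bound cancels the 1/4 in the Lagrange identity: the relative loss is at most \<open>?d j\<close>.\<close>
  have q: "1 / 4 \<le> ?q j" for j
    using mult_mono[of "1/2" "(1 + exp (- (2 * a j))) / 2" "1/2" "(1 + exp (- (2 * b j))) / 2"]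
    by simp
  have limp: "(\<lambda>N. \<Prod>j\<in>?I N. ?p j) \<longlonglongrightarrow> (laplace (\<lambda>j. a j + b j))\<^sup>2"
    unfolding prod_power_distrib[symmetric]
    by (intro tendsto_power laplace_eq_infinite_prod summable_on_add) (use a b in auto)
  have limq: "(\<lambda>N. \<Prod>j\<in>?I N. ?q j) \<longlonglongrightarrow> laplace (\<lambda>j. 2 * a j) * laplace (\<lambda>j. 2 * b j)"
    unfolding prod.distrib
    by (intro tendsto_mult laplace_eq_infinite_prod summable_on_cmult_right) (use a b in auto)
  have "(1 - S) * (\<Prod>j\<in>?I N. ?q j) \<le> (\<Prod>j\<in>?I N. ?p j)" for N
  proof -
    have "(1 - S) * (\<Prod>j\<in>?I N. ?q j) \<le> (1 - (\<Sum>j\<in>?I N. ?d j)) * (\<Prod>j\<in>?I N. ?q j)"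
      using S[of N] by (intro mult_right_mono prod_nonneg) auto
    also have "\<dots> \<le> (\<Prod>j\<in>?I N. ?p j)"
    proof (rule one_minus_sum_times_prod_le)
      fix j
      have "?d j * (1 / 4) \<le> ?d j * ?q j" by (intro mult_left_mono q) auto
      then show "(1 - ?d j) * ?q j \<le> ?p j"
        unfolding lagrange left_diff_distrib by linarith
      show "0 \<le> ?q j" using q[of j] by linarith
    qed auto
    finally show ?thesis .
  qed
  then show "(1 - S) * (laplace (\<lambda>j. 2 * a j) * laplace (\<lambda>j. 2 * b j)) \<le> (laplace (\<lambda>j. a j + b j))\<^sup>2"
    by (intro LIMSEQ_le[OF tendsto_mult[OF tendsto_const limq] limp]) auto
  have "?p j \<le> ?q j" for j 
    using lagrange[of j] zero_le_power2[of "exp (- a j) - exp (- b j)"] by linarith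
  then have "(\<Prod>j\<in>?I N. ?p j) \<le> (\<Prod>j\<in>?I N. ?q j)" for N
    by (intro prod_mono conjI) auto
  then show "(laplace (\<lambda>j. a j + b j))\<^sup>2 \<le> laplace (\<lambda>j. 2 * a j) * laplace (\<lambda>j. 2 * b j)"
    by (intro LIMSEQ_le[OF limp limq]) auto
qed

section \<open>Variation of the one-site profile\<close>

text \<open>The value of \<open>exp (- a\<^sub>j)\<close> as a function of \<open>t = |j|\<close>, extended to negative \<open>t\<close> by the same formula.
  The extension keeps monotonicity and bounds, so arguments such as \<open>|j| - B\<close> need no truncation.\<close>

definition profile :: "nat \<Rightarrow> real \<Rightarrow> real" where
  "profile n t = exp (- real n * exp (- t / real n))"

lemma profile_range: "0 \<le> profile n t" "profile n t \<le> 1"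
  by (auto simp: profile_def)

lemma profile_mono: "s \<le> t \<Longrightarrow> profile n s \<le> profile n t"
  by (cases "n = 0") (auto simp: profile_def divide_right_mono)

text \<open>With \<open>u = e\<^bsup>-t/n\<^esup>\<close> the derivative of the profile is \<open>u e\<^bsup>-nu\<^esup>\<close>, which is at most \<open>1/n\<close> since
  \<open>nu \<le> e\<^bsup>nu\<^esup>\<close>.\<close>

lemma profile_lipschitz:
  assumes "n \<ge> 1" "s \<le> t"
  shows "profile n t - profile n s \<le> (t - s) / real n"
proof -
  define F where "F = (\<lambda>t. t / real n - profile n t)"
  have "F s \<le> F t"
  proof (rule DERIV_nonneg_imp_nondecreasing[OF assms(2)])
    fix r
    let ?u = "exp (- r / real n)"
    have "(F has_real_derivative (1 / real n - ?u * exp (- real n * ?u))) (at r)"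
      unfolding F_def profile_def using assms(1) by (auto intro!: derivative_eq_intros)
    moreover have "real n * ?u \<le> exp (real n * ?u)"
      using exp_ge_add_one_self[of "real n * ?u"] by linarith
    then have "?u * exp (- real n * ?u) \<le> 1 / real n"
      using assms(1) by (simp add: exp_minus field_simps)
    ultimately show "\<exists>y. (F has_real_derivative y) (at r) \<and> 0 \<le> y"
      by (intro exI[of _ "1 / real n - ?u * exp (- real n * ?u)"]) simp
  qed
  then show ?thesis by (simp add: F_def diff_divide_distrib)
qed

text \<open>A shift by \<open>L\<close> is a composition of \<open>L\<close> unit shifts, and the sum for a unit shift telescopes to
  a difference of two values in \<open>[0, 1]\<close>.\<close>

lemma sum_shift_difference_le:
  fixes \<phi> :: "real \<Rightarrow> real"
  assumes "\<And>t. 0 \<le> \<phi> t" "\<And>t. \<phi> t \<le> 1"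
  shows "(\<Sum>m<K. \<phi> (real m + s + real L) - \<phi> (real m + s)) \<le> real L"
proof (induction L)
  case (Suc L)
  have "(\<Sum>m<K. \<phi> (real (Suc m) + s + real L) - \<phi> (real m + s + real L))
      = \<phi> (real K + s + real L) - \<phi> (real 0 + s + real L)"
    by (rule sum_lessThan_telescope)
  also have "\<dots> \<le> 1" using assms(1)[of "real 0 + s + real L"] assms(2)[of "real K + s + real L"] by linarith
  finally have "(\<Sum>m<K. \<phi> (real (Suc m) + s + real L) - \<phi> (real m + s + real L)) \<le> 1" .
  moreover have "real m + s + real (Suc L) = real (Suc m) + s + real L" for m by simp
  ultimately show ?case using Suc.IH by (simp add: sum_subtractf add_ac)
qed simp

lemma sum_symmetric_interval_abs_le:
  fixes d :: "nat \<Rightarrow> real"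
  assumes "\<And>m. 0 \<le> d m"
  shows "(\<Sum>j\<in>{- int N..int N}. d (nat \<bar>j\<bar>)) \<le> 2 * (\<Sum>m<Suc N. d m)"
proof (induction N)
  case (Suc N)
  have "{- int (Suc N)..int (Suc N)} = insert (- int (Suc N)) (insert (int (Suc N)) {- int N..int N})"
    by auto
  moreover have "nat (1 + int N) = Suc N" by simp
  ultimately show ?case using Suc.IH by (simp add: add.commute)
qed (use assms[of 0] in simp)

definition weight :: "nat \<Rightarrow> int \<Rightarrow> real" where
  "weight n j = real n * exp (- real_of_int \<bar>j\<bar> / real n)"

text \<open>Since \<open>|h j|\<close> and \<open>|j|\<close> both lie in \<open>[|j| - B, |j| + B]\<close>, the difference is bounded by the
  increment \<open>d |j|\<close> of the profile over this interval. One factor of the square is estimated by the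
  Lipschitz bound \<open>2B/n\<close>; the sum of the other factors telescopes to at most \<open>4B\<close>.\<close>

lemma sum_profile_displacement_le:
  assumes n: "n \<ge> 1" and h: "\<And>j. \<bar>h j - j\<bar> \<le> int B"
  shows "(\<Sum>j\<in>{- int N..int N}. (exp (- weight n j) - exp (- weight n (h j)))\<^sup>2)
           \<le> 8 * (real B)\<^sup>2 / real n"
proof -
  define d where "d m = profile n (real m - real B + real (2 * B)) - profile n (real m - real B)" for m
  have d0: "0 \<le> d m" for m unfolding d_def by (simp add: profile_mono)
  have dn: "d m \<le> 2 * real B / real n" for m
    using profile_lipschitz[OF n, of "real m - real B" "real m - real B + real (2 * B)"]
    by (simp add: d_def)
  have w: "exp (- weight n j) = profile n \<bar>real_of_int j\<bar>" for j
    by (simp add: weight_def profile_def)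
  have term_le: "(exp (- weight n j) - exp (- weight n (h j)))\<^sup>2 \<le> 2 * real B / real n * d (nat \<bar>j\<bar>)" for j
  proof -
    let ?m = "real (nat \<bar>j\<bar>)"
    have m: "?m = \<bar>real_of_int j\<bar>" by simp
    have "\<bar>real_of_int (h j) - real_of_int j\<bar> \<le> real B"
      using h[of j] by linarith
    then have b: "?m - real B \<le> \<bar>real_of_int (h j)\<bar>" "\<bar>real_of_int (h j)\<bar> \<le> ?m - real B + real (2 * B)"
      unfolding m by auto
    have c: "?m - real B \<le> \<bar>real_of_int j\<bar>" "\<bar>real_of_int j\<bar> \<le> ?m - real B + real (2 * B)"
      by auto
    have "\<bar>exp (- weight n j) - exp (- weight n (h j))\<bar> \<le> d (nat \<bar>j\<bar>)"
      unfolding w d_def using b[THEN profile_mono, of n] c[THEN profile_mono, of n] by linarith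
    then have "(exp (- weight n j) - exp (- weight n (h j)))\<^sup>2 \<le> (d (nat \<bar>j\<bar>))\<^sup>2"
      by (rule abs_le_square_iff[THEN iffD1, OF order_trans]) (simp add: d0)
    also have "\<dots> \<le> 2 * real B / real n * d (nat \<bar>j\<bar>)"
      unfolding power2_eq_square by (intro mult_right_mono dn d0)
    finally show ?thesis .
  qed
  have "(\<Sum>j\<in>{- int N..int N}. (exp (- weight n j) - exp (- weight n (h j)))\<^sup>2)
      \<le> 2 * real B / real n * (\<Sum>j\<in>{- int N..int N}. d (nat \<bar>j\<bar>))"
    unfolding sum_distrib_left by (intro sum_mono term_le)
  also have "\<dots> \<le> 2 * real B / real n * (2 * (\<Sum>m<Suc N. d m))"
    by (intro mult_left_mono sum_symmetric_interval_abs_le d0) auto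
  also have "\<dots> \<le> 2 * real B / real n * (2 * real (2 * B))"
    using sum_shift_difference_le[of "profile n" "- real B" "2 * B" "Suc N", OF profile_range]
    by (intro mult_left_mono) (auto simp: d_def)
  also have "\<dots> = 8 * (real B)\<^sup>2 / real n" by (simp add: power2_eq_square)
  finally show ?thesis .
qed

section \<open>Norms and matrix coefficients of \<open>f\<^sub>n\<close>\<close>

lemma weight_nonneg: "0 \<le> weight n j"
  by (simp add: weight_def)

lemma weight_summable: "n \<ge> 1 \<Longrightarrow> weight n summable_on UNIV"
  unfolding weight_def using f_summable[of n "\<lambda>_. True"]
  by (intro summable_on_cmult_right) simp

lemma f_eq_exp_weight: "f n x = exp (- (\<Sum>\<^sub>\<infinity>j\<in>UNIV. of_bool (x j) * weight n j))"
  unfolding f_def weight_def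
  by (simp add: mult.left_commute[of _ "real n"] infsum_cmult_right')

text \<open>Moving the permutation from the point to the weights keeps the product within the family of
  exponentials whose integrals are \<open>laplace\<close>.\<close>

lemma f_mult_permuted:
  assumes n: "n \<ge> 1" and h: "bij h"
  shows "f n (\<lambda>j. x (inv h j)) * f n x = exp (- (\<Sum>\<^sub>\<infinity>j\<in>UNIV. of_bool (x j) * (weight n j + weight n (h j))))"
proof -
  have "(\<Sum>\<^sub>\<infinity>j\<in>UNIV. of_bool (x (inv h j)) * weight n j)
      = (\<Sum>\<^sub>\<infinity>j\<in>UNIV. of_bool (x (inv h (h j))) * weight n (h j))"
    by (rule infsum_reindex_bij_betw[OF h, symmetric])
  also have "\<dots> = (\<Sum>\<^sub>\<infinity>j\<in>UNIV. of_bool (x j) * weight n (h j))"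
    using h by (simp add: bij_is_inj)
  finally have 1: "(\<Sum>\<^sub>\<infinity>j\<in>UNIV. of_bool (x (inv h j)) * weight n j)
      = (\<Sum>\<^sub>\<infinity>j\<in>UNIV. of_bool (x j) * weight n (h j))" .
  have s: "(\<lambda>j. weight n (h j)) summable_on UNIV"
    using summable_on_reindex_bij_betw[OF h] weight_summable[OF n] by blast
  have "(\<Sum>\<^sub>\<infinity>j\<in>UNIV. of_bool (x j) * (weight n j + weight n (h j)))
      = (\<Sum>\<^sub>\<infinity>j\<in>UNIV. of_bool (x j) * weight n j) + (\<Sum>\<^sub>\<infinity>j\<in>UNIV. of_bool (x j) * weight n (h j))"
    unfolding distrib_left
    by (intro infsum_add summable_on_selection weight_nonneg s weight_summable n)
  then show ?thesis unfolding f_eq_exp_weight 1 by (simp flip: exp_add)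
qed

lemma L2_inner_act_f:
  assumes n: "n \<ge> 1" and g: "bij g"
  shows "L2_inner (act_fun g (f n)) (f n) = laplace (\<lambda>j. weight n j + weight n (inv g j))"
  unfolding L2_inner_def act_fun_def act_def laplace_def
  using f_mult_permuted[OF n bij_imp_bij_inv[OF g]] by simp

lemma L2_norm_f_square:
  assumes n: "n \<ge> 1"
  shows "(L2_norm (f n))\<^sup>2 = laplace (\<lambda>j. 2 * weight n j)"
proof -
  have "f n x * f n x = exp (- (\<Sum>\<^sub>\<infinity>j\<in>UNIV. of_bool (x j) * (2 * weight n j)))" for x
    using f_mult_permuted[OF n bij_id, of x] by simp
  then have "L2_inner (f n) (f n) = laplace (\<lambda>j. 2 * weight n j)"
    by (simp add: L2_inner_def laplace_def)
  moreover have "0 < laplace (\<lambda>j. 2 * weight n j)"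
    by (intro laplace_pos summable_on_cmult_right weight_summable n) (simp add: weight_nonneg)
  ultimately show ?thesis by (simp add: L2_norm_def)
qed

text \<open>The integrand is again an infinite product of functions of single coordinates, whose factor at 0 is
  the indicator of \<open>x\<^sub>0 = 0\<close>. Its product of averages differs from that of \<open>f\<^sub>n\<^sup>2\<close> only at 0.\<close>

lemma L2_norm_restrict_f_square:
  assumes n: "n \<ge> 1"
  shows "(1 + exp (- (2 * real n))) * (L2_norm (restrict_cyl (f n)))\<^sup>2 = (L2_norm (f n))\<^sup>2"
proof -
  let ?I = "\<lambda>N. {- int N..int N}"
  let ?c = "\<lambda>j. 2 * weight n j"
  have c: "0 \<le> ?c j" "?c summable_on UNIV" for j
    using weight_nonneg weight_summable[OF n] by (auto intro: summable_on_cmult_right)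
  define w where "w j b = (if j = 0 \<and> b then 0 else exp (- (of_bool b * ?c j)))" for j b
  let ?h = "\<lambda>x. restrict_cyl (f n) x * restrict_cyl (f n) x"
  have "(\<lambda>N. \<Prod>j\<in>?I N. w j (x j)) \<longlonglongrightarrow> ?h x" for x
  proof (cases "x 0")
    case True
    then have "(\<Prod>j\<in>?I N. w j (x j)) = 0" for N
      by (intro prod_zero) (auto simp: w_def intro!: bexI[of _ 0])
    then have "(\<lambda>N. \<Prod>j\<in>?I N. w j (x j)) = (\<lambda>_. 0)" by (rule ext)
    then show ?thesis using True by (simp only:) (simp add: restrict_cyl_def)
  next
    case False
    then have "w j (x j) = exp (- (of_bool (x j) * ?c j))" for j
      by (auto simp: w_def)
    moreover have "?h x = exp (- (\<Sum>\<^sub>\<infinity>j\<in>UNIV. of_bool (x j) * ?c j))"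
      using f_mult_permuted[OF n bij_id, of x] False by (simp add: restrict_cyl_def)
    ultimately show ?thesis using selection_prod_tendsto[of ?c x] c by simp
  qed
  then have "(\<lambda>N. \<Prod>j\<in>?I N. (w j False + w j True) / 2) \<longlonglongrightarrow> L2_inner (restrict_cyl (f n)) (restrict_cyl (f n))"
    unfolding L2_inner_def
    by (intro integral_bernoulli_infinite_prod) (auto simp: w_def weight_nonneg)
  then have "(\<lambda>N. (1 + exp (- ?c 0)) * (\<Prod>j\<in>?I N. (w j False + w j True) / 2))
      \<longlonglongrightarrow> (1 + exp (- ?c 0)) * L2_inner (restrict_cyl (f n)) (restrict_cyl (f n))"
    by (intro tendsto_intros)
  moreover have "(1 + exp (- ?c 0)) * (\<Prod>j\<in>?I N. (w j False + w j True) / 2) = (\<Prod>j\<in>?I N. (1 + exp (- ?c j)) / 2)" for N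
  proof -
    have "(\<Prod>j\<in>?I N - {0}. (w j False + w j True) / 2) = (\<Prod>j\<in>?I N - {0}. (1 + exp (- ?c j)) / 2)"
      by (intro prod.cong) (auto simp: w_def)
    then show ?thesis
      by (simp add: prod.remove[of "?I N" 0] w_def)
  qed
  ultimately have "(\<lambda>N. \<Prod>j\<in>?I N. (1 + exp (- ?c j)) / 2)
      \<longlonglongrightarrow> (1 + exp (- ?c 0)) * L2_inner (restrict_cyl (f n)) (restrict_cyl (f n))"
    by simp
  then have "(1 + exp (- ?c 0)) * L2_inner (restrict_cyl (f n)) (restrict_cyl (f n)) = laplace ?c"
    using LIMSEQ_unique laplace_eq_infinite_prod[OF c] by blast
  moreover have "0 \<le> L2_inner (restrict_cyl (f n)) (restrict_cyl (f n))"
    unfolding L2_inner_def by (intro integral_nonneg_AE) auto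
  ultimately show ?thesis
    unfolding L2_norm_f_square[OF n] by (simp add: L2_norm_def weight_def)
qed

lemma L2_norm_f_pos:
  assumes n: "n \<ge> 1"
  shows "0 < L2_norm (f n)"
proof -
  have "0 < (L2_norm (f n))\<^sup>2"
    unfolding L2_norm_f_square[OF n]
    by (intro laplace_pos summable_on_cmult_right weight_summable n) (simp add: weight_nonneg)
  moreover have "0 \<le> L2_norm (f n)"
    unfolding L2_norm_def L2_inner_def by (intro real_sqrt_ge_zero integral_nonneg_AE) auto
  ultimately show ?thesis by (cases "L2_norm (f n) = 0") auto
qed

text \<open>The bounds are for \<open>r\<^sup>2\<close> since the factorwise comparison is between squares; \<open>0 \<le> r\<close> is what allows
  taking the root. Permutation invariance merges the two transforms in the comparison into \<open>\<parallel>f\<^sub>n\<parallel>\<^sup>4\<close>.\<close>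

lemma normalized_coefficient_bounds:
  assumes n: "n \<ge> 1" and g: "bij g" and B: "\<And>j. \<bar>inv g j - j\<bar> \<le> int B"
  defines "r \<equiv> L2_inner (act_fun g (f n)) (f n) / (L2_norm (f n))\<^sup>2"
  shows "0 \<le> r" "1 - 8 * (real B)\<^sup>2 / real n \<le> r\<^sup>2" "r\<^sup>2 \<le> 1"
proof -
  let ?a = "weight n" and ?b = "\<lambda>j. weight n (inv g j)"
  let ?A = "laplace (\<lambda>j. 2 * ?a j)"
  have h: "bij (inv g)" by (rule bij_imp_bij_inv[OF g])
  have b: "?b summable_on UNIV"
    using summable_on_reindex_bij_betw[OF h] weight_summable[OF n] by blast
  have A: "0 < ?A"
    by (intro laplace_pos summable_on_cmult_right weight_summable n) (simp add: weight_nonneg)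
  have AB: "laplace (\<lambda>j. 2 * ?b j) = ?A"
    using laplace_permute[OF _ _ h, of "\<lambda>j. 2 * ?a j"] weight_summable[OF n]
    by (simp add: weight_nonneg summable_on_cmult_right)
  have r: "r = laplace (\<lambda>j. ?a j + ?b j) / ?A"
    unfolding r_def L2_inner_act_f[OF n g] L2_norm_f_square[OF n] ..
  note bounds = laplace_almost_multiplicative[of ?a ?b, OF weight_nonneg weight_summable[OF n]
      weight_nonneg b sum_profile_displacement_le[OF n B], unfolded AB]
  show "0 \<le> r"
    unfolding r using A
    by (intro divide_nonneg_pos less_imp_le[OF laplace_pos] summable_on_add weight_summable n b)
      (auto simp: weight_nonneg)
  show "1 - 8 * (real B)\<^sup>2 / real n \<le> r\<^sup>2"
    using bounds(1) A by (simp add: r power_divide pos_le_divide_eq power2_eq_square)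
  show "r\<^sup>2 \<le> 1"
    using bounds(2) A by (simp add: r power_divide pos_divide_le_eq power2_eq_square)
qed

theorem theorem2p1:
  shows "(\<forall>g\<in>W. (\<lambda>n. L2_inner (act_fun g (f n)) (f n) / (L2_norm (f n))\<^sup>2) \<longlonglongrightarrow> 1) \<and>
         (\<lambda>n. L2_norm (restrict_cyl (f n)) / L2_norm (f n)) \<longlonglongrightarrow> 1"
proof (intro conjI ballI)
  fix g assume gW: "g \<in> W"
  then have g: "bij g" by (simp add: W_def)
  from inv_in_W[OF gW] obtain C where "\<And>j. \<bar>inv g j - j\<bar> \<le> C"
    unfolding W_def wnorm_finite_iff by auto
  then have B: "\<bar>inv g j - j\<bar> \<le> int (nat C)" for j
    using \<open>\<And>j. \<bar>inv g j - j\<bar> \<le> C\<close>[of j] by linarith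
  define r where "r n = L2_inner (act_fun g (f n)) (f n) / (L2_norm (f n))\<^sup>2" for n
  note bounds = normalized_coefficient_bounds[OF _ g B, folded r_def]
  have "(\<lambda>n. (r n)\<^sup>2) \<longlonglongrightarrow> 1"
  proof (rule tendsto_sandwich)
    show "(\<lambda>n. 1 - 8 * (real (nat C))\<^sup>2 / real n) \<longlonglongrightarrow> 1"
      using tendsto_diff[OF tendsto_const lim_const_over_n] by fastforce
    show "\<forall>\<^sub>F n in sequentially. 1 - 8 * (real (nat C))\<^sup>2 / real n \<le> (r n)\<^sup>2"
      using eventually_ge_at_top[of 1] by eventually_elim (rule bounds)
    show "\<forall>\<^sub>F n in sequentially. (r n)\<^sup>2 \<le> 1"
      using eventually_ge_at_top[of 1] by eventually_elim (rule bounds)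
  qed simp
  then have "(\<lambda>n. sqrt ((r n)\<^sup>2)) \<longlonglongrightarrow> sqrt 1" by (rule tendsto_real_sqrt)
  moreover have "\<forall>\<^sub>F n in sequentially. sqrt ((r n)\<^sup>2) = r n"
    using eventually_ge_at_top[of 1] by eventually_elim (simp add: bounds)
  ultimately have "r \<longlonglongrightarrow> 1" using tendsto_cong by force
  then show "(\<lambda>n. L2_inner (act_fun g (f n)) (f n) / (L2_norm (f n))\<^sup>2) \<longlonglongrightarrow> 1"
    by (simp add: r_def[abs_def])
next
  have "(\<lambda>n. exp (- 2) ^ n :: real) \<longlonglongrightarrow> 0" by (intro LIMSEQ_power_zero) simp
  then have "(\<lambda>n. exp (- (2 * real n))) \<longlonglongrightarrow> 0"
    by (simp add: mult.commute flip: exp_of_nat_mult)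
  then have "(\<lambda>n. sqrt (1 / (1 + exp (- (2 * real n))))) \<longlonglongrightarrow> sqrt (1 / (1 + 0))"
    by (intro tendsto_intros) auto
  moreover have "\<forall>\<^sub>F n in sequentially.
      sqrt (1 / (1 + exp (- (2 * real n)))) = L2_norm (restrict_cyl (f n)) / L2_norm (f n)"
    using eventually_ge_at_top[of 1]
  proof eventually_elim
    case (elim n)
    have "0 \<le> L2_norm (restrict_cyl (f n))"
      unfolding L2_norm_def L2_inner_def by (intro real_sqrt_ge_zero integral_nonneg_AE) auto
    moreover have "1 / (1 + exp (- (2 * real n))) = (L2_norm (restrict_cyl (f n)) / L2_norm (f n))\<^sup>2"
    proof -
      have "1 + exp (- (2 * real n)) \<noteq> 0"
        using exp_gt_zero[of "- (2 * real n)"] by linarith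
      moreover have "L2_norm (f n) \<noteq> 0" using L2_norm_f_pos[OF elim] by simp
      ultimately show ?thesis
        using L2_norm_restrict_f_square[OF elim]
        by (simp add: power_divide frac_eq_eq mult.commute[of "(L2_norm _)\<^sup>2"])
    qed
    ultimately show ?case using L2_norm_f_pos[OF elim] by simp
  qed
  ultimately show "(\<lambda>n. L2_norm (restrict_cyl (f n)) / L2_norm (f n)) \<longlonglongrightarrow> 1"
    using tendsto_cong by force
qed

end
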